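(* Let $\mathscr{H}$ be a real Hilbert space and let $f:\mathscr{H}\to\mathbb{R}\cup\{+\infty\}$ be closed, convex and proper. For every real $\rho\neq0$, every real $\gamma>0$ and every $\bm{v}\in\mathscr{H}$, $$\mathbf{Prox}_{f\rho}(\bm{v})=\frac1\rho\,\mathbf{Prox}_{\rho^2f}(\rho\bm{v}),\qquad \mathbf{Prox}_{\gamma f}(\bm{v})=\sqrt{\gamma}\,\mathbf{Prox}_{f\sqrt{\gamma}}\Big(\frac{\bm{v}}{\sqrt{\gamma}}\Big).$$
   Context: Two proximal operators are used. The classical one, with the scalar written on the left and $\gamma>0$: $\mathbf{Prox}_{\gamma f}(\bm{v})=\operatorname*{argmin}_{\bm{z}}\,\gamma f(\bm{z})+\frac12\|\bm{z}-\bm{v}\|^2$. The new one, with the scalar written on the right and $\rho\neq0$: $\mathbf{Prox}_{f\rho}(\bm{v})=\operatorname*{argmin}_{\bm{z}}\, f(\rho\bm{z})+\frac12\|\bm{z}-\bm{v}\|^2$. Both denote the unique minimizer. *)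

theory Defs
  imports "HOL-Analysis.Analysis"
begin

text \<open>Extended-real-valued functions with values in \<open>\<real> \<union> {+\<infinity>}\<close> are modelled as functions into
  \<^typ>\<open>ereal\<close> that never take the value \<open>-\<infinity>\<close>; this requirement is part of \<open>proper_fun\<close>.\<close>

definition proper_fun :: "('a \<Rightarrow> ereal) \<Rightarrow> bool" where
  "proper_fun f \<longleftrightarrow> (\<forall>x. f x \<noteq> -\<infinity>) \<and> (\<exists>x. f x \<noteq> \<infinity>)"

definition closed_fun :: "('a::topological_space \<Rightarrow> ereal) \<Rightarrow> bool" where
  "closed_fun f \<longleftrightarrow> closed {(x, r :: real). f x \<le> ereal r}"

text \<open>The endpoints \<open>t = 0\<close> and \<open>t = 1\<close> impose no condition, since \<open>0 * \<infinity> = 0\<close> in \<^typ>\<open>ereal\<close>. The library's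
  \<^const>\<open>convex_on\<close> covers real-valued functions only.\<close>

definition convex_fun :: "('a::real_vector \<Rightarrow> ereal) \<Rightarrow> bool" where
  "convex_fun f \<longleftrightarrow> (\<forall>x y. \<forall>t\<in>{0..1::real}.
     f ((1 - t) *\<^sub>R x + t *\<^sub>R y) \<le> ereal (1 - t) * f x + ereal t * f y)"

text \<open>\<open>prox \<gamma> f v\<close> is the classical operator, with the scalar scaling the value of \<open>f\<close>;
  \<open>prox_right f \<rho> v\<close> has the scalar inside the argument of \<open>f\<close>. Each is the unique minimizer and is
  unspecified when there is no unique minimizer.\<close>

definition prox :: "real \<Rightarrow> ('a::real_inner \<Rightarrow> ereal) \<Rightarrow> 'a \<Rightarrow> 'a" where
  "prox \<gamma> f v = (THE z. is_arg_min
     (\<lambda>z. ereal \<gamma> * f z + ereal (1 / 2 * (norm (z - v))\<^sup>2)) (\<lambda>_. True) z)"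

definition prox_right :: "('a::real_inner \<Rightarrow> ereal) \<Rightarrow> real \<Rightarrow> 'a \<Rightarrow> 'a" where
  "prox_right f \<rho> v = (THE z. is_arg_min
     (\<lambda>z. f (\<rho> *\<^sub>R z) + ereal (1 / 2 * (norm (z - v))\<^sup>2)) (\<lambda>_. True) z)"

end

(* Multiplying the objective of prox_right at z by \<rho>\<^sup>2 gives the objective of prox at \<rho> z, so the
   minimizers correspond under z \<mapsto> \<rho> z. Since the operators are definite descriptions, this yields
   an equation only once the minimizer exists and is unique. By strong convexity any minimizing
   sequence is Cauchy, and closedness of the epigraph makes its limit a minimizer. Boundedness
   from below needs no separation theorem: closedness bounds f below near a point of its domain,
   and convexity propagates this to a lower bound that is linear in the norm. *)

theory Submission
  imports Defs
begin

section \<open>Real epigraph heights and a lower bound linear in the norm\<close>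

lemma convex_funD_real:
  assumes "convex_fun f" "f x \<le> ereal a" "f y \<le> ereal b" "0 \<le> t" "t \<le> 1"
  shows "f ((1 - t) *\<^sub>R x + t *\<^sub>R y) \<le> ereal ((1 - t) * a + t * b)"
proof -
  have "f ((1 - t) *\<^sub>R x + t *\<^sub>R y) \<le> ereal (1 - t) * f x + ereal t * f y"
    using assms by (simp add: convex_fun_def)
  also have "\<dots> \<le> ereal (1 - t) * ereal a + ereal t * ereal b"
    using assms by (intro add_mono ereal_mult_left_mono) auto
  finally show ?thesis by simp
qed

lemma closed_fun_tendsto_le:
  fixes f :: "'a::metric_space \<Rightarrow> ereal"
  assumes "closed_fun f" "\<And>n. f (X n) \<le> ereal (r n)" "X \<longlonglongrightarrow> x" "r \<longlonglongrightarrow> a"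
  shows "f x \<le> ereal a"
proof -
  let ?E = "{(x, r :: real). f x \<le> ereal r}"
  have "closed ?E" using assms(1) by (simp add: closed_fun_def)
  moreover have "(X n, r n) \<in> ?E" for n using assms(2) by simp
  moreover have "(\<lambda>n. (X n, r n)) \<longlonglongrightarrow> (x, a)"
    by (intro tendsto_Pair assms)
  ultimately have "(x, a) \<in> ?E" by (rule closed_sequentially)
  then show ?thesis by auto
qed

text \<open>The point \<open>(x0, a - 1)\<close> lies strictly below the graph, and the complement
  of the epigraph is open, so \<open>f\<close> exceeds \<open>a - 1\<close> on a ball around
  \<open>x0\<close>. Convexity along the segment from \<open>x0\<close> to a point outside the ball
  limits the descent to slope \<open>1 / d\<close>.\<close>

lemma closed_convex_fun_linear_lower_bound:
  fixes f :: "'a::real_normed_vector \<Rightarrow> ereal"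
  assumes "closed_fun f" "convex_fun f" "proper_fun f"
  shows "\<exists>x0 c d. d > 0 \<and> (\<forall>x r. f x \<le> ereal r \<longrightarrow> c - norm (x - x0) / d \<le> r)"
proof -
  obtain x0 where "f x0 \<noteq> \<infinity>" "f x0 \<noteq> -\<infinity>"
    using assms(3) by (auto simp: proper_fun_def)
  then obtain a where a: "f x0 = ereal a" by (cases "f x0") auto
  let ?E = "{(x, r :: real). f x \<le> ereal r}"
  have "open (- ?E)" using assms(1) by (simp add: closed_fun_def open_Compl)
  moreover have "(x0, a - 1) \<in> - ?E" using a by simp
  ultimately obtain e where e: "e > 0" "ball (x0, a - 1) e \<subseteq> - ?E"
    by (meson openE)
  \<comment> \<open>Halving puts the closed ball of radius \<open>d\<close> inside the open ball of
    radius \<open>e\<close>; points at distance exactly \<open>d\<close> are used below.\<close>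
  define d where "d = e / 2"
  have d: "d > 0" using e by (simp add: d_def)
  have near: "\<not> f x \<le> ereal (a - 1)" if "norm (x - x0) \<le> d" for x
  proof -
    have "(x, a - 1) \<in> ball (x0, a - 1) e"
      using that e by (simp add: dist_Pair_Pair dist_norm norm_minus_commute d_def)
    then show ?thesis using e by blast
  qed
  have "r \<ge> (a - 1) - norm (x - x0) / d" if r: "f x \<le> ereal r" for x r
  proof (cases "norm (x - x0) \<le> d")
    case True
    have "r > a - 1"
    proof (rule ccontr)
      assume "\<not> r > a - 1"
      then have "f x \<le> ereal (a - 1)" using r by (meson ereal_less_eq(3) linorder_not_less order_trans)
      then show False using near[OF True] by simp
    qed
    moreover have "norm (x - x0) / d \<ge> 0" using d by simp
    ultimately show ?thesis by linarith
  next
    case False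
    define D where "D = norm (x - x0)"
    \<comment> \<open>This \<open>t\<close> puts \<open>?y\<close> on the segment at distance
      exactly \<open>d\<close> from \<open>x0\<close>, where \<open>near\<close> still
      applies.\<close>
    define t where "t = d / D"
    have D: "D > d" using False by (simp add: D_def)
    have t: "0 < t" "t < 1" "t * D = d" using D d by (auto simp: t_def)
    let ?y = "(1 - t) *\<^sub>R x0 + t *\<^sub>R x"
    have "?y - x0 = t *\<^sub>R (x - x0)" by (simp add: algebra_simps)
    then have "norm (?y - x0) = t * D" using t by (simp add: D_def)
    then have "\<not> f ?y \<le> ereal (a - 1)" using near t by simp
    moreover have "f ?y \<le> ereal ((1 - t) * a + t * r)"
      using assms(2) r t a by (intro convex_funD_real) auto
    ultimately have "(1 - t) * a + t * r > a - 1"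
      by (meson ereal_less_eq(3) linorder_not_less order_trans)
    then have "t * (r - a) > -1" by (simp add: algebra_simps)
    then have "r - a > - (1 / t)" using t by (simp add: field_simps)
    moreover have "1 / t = D / d" by (simp add: t_def)
    ultimately show ?thesis by (simp add: D_def)
  qed
  then show ?thesis using d by blast
qed

section \<open>Strong convexity, existence and uniqueness of the minimizer\<close>

text \<open>This is the parallelogram law for \<open>x - v\<close> and \<open>y - v\<close>. The
  coefficient \<open>1 - 1/2\<close> is left unevaluated to match \<open>convex_funD_real\<close> at
  \<open>t = 1/2\<close>.\<close>

lemma norm_midpoint_square:
  fixes x y v :: "'a::real_inner"
  shows "(norm ((1 - 1/2) *\<^sub>R x + (1/2) *\<^sub>R y - v))\<^sup>2
    = ((norm (x - v))\<^sup>2 + (norm (y - v))\<^sup>2) / 2 - (norm (x - y))\<^sup>2 / 4"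
proof -
  define p q where "p = x - v" and "q = y - v"
  have "(1 - 1/2) *\<^sub>R x + (1/2) *\<^sub>R y - v = (1/2) *\<^sub>R (p + q)"
    unfolding p_def q_def using scaleR_half_double[of v] by (simp add: algebra_simps)
  moreover have "x - y = p - q" by (simp add: p_def q_def)
  moreover have "(norm ((1/2) *\<^sub>R (p + q)))\<^sup>2
      = ((norm p)\<^sup>2 + (norm q)\<^sup>2) / 2 - (norm (p - q))\<^sup>2 / 4"
    unfolding power2_norm_eq_inner by (simp add: inner_simps inner_commute[of q p], argo)
  ultimately show ?thesis by (simp only: p_def q_def)
qed

text \<open>At the midpoint the objective is at least \<open>m\<close>, yet at most the average of
  the two values minus \<open>(norm (x - y))\<^sup>2 / 8\<close>. Points with small excess over
  \<open>m\<close> are thus close together, which gives both the Cauchy property and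
  uniqueness.\<close>

lemma prox_objective_midpoint:
  fixes f :: "'a::real_inner \<Rightarrow> ereal"
  assumes "convex_fun f" "f x \<le> ereal a" "f y \<le> ereal b"
    and lower: "\<And>z r. f z \<le> ereal r \<Longrightarrow> m \<le> \<gamma> * r + (norm (z - v))\<^sup>2 / 2"
  shows "(norm (x - y))\<^sup>2 / 4
    \<le> (\<gamma> * a + (norm (x - v))\<^sup>2 / 2 - m) + (\<gamma> * b + (norm (y - v))\<^sup>2 / 2 - m)"
proof -
  have "f ((1 - 1/2) *\<^sub>R x + (1/2) *\<^sub>R y) \<le> ereal ((1 - 1/2) * a + 1/2 * b)"
    using assms by (intro convex_funD_real) auto
  note lower[OF this, unfolded norm_midpoint_square]
  moreover have "\<gamma> * ((1 - 1/2) * a + 1/2 * b) = (\<gamma> * a + \<gamma> * b) / 2"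
    by (simp add: distrib_left)
  ultimately show ?thesis by argo
qed

text \<open>Minimizing over epigraph points \<open>(x, r)\<close> keeps the objective real-valued,
  so that infima and limits are taken in the reals.\<close>

lemma epigraph_prox_objective_minimizer:
  fixes f :: "'a::{real_inner, complete_space} \<Rightarrow> ereal"
  assumes "closed_fun f" "convex_fun f" "proper_fun f" "\<gamma> > 0"
  shows "\<exists>z a. f z \<le> ereal a \<and>
    (\<forall>x r. f x \<le> ereal r \<longrightarrow> \<gamma> * a + (norm (z - v))\<^sup>2 / 2 \<le> \<gamma> * r + (norm (x - v))\<^sup>2 / 2)"
proof -
  let ?q = "\<lambda>x r. \<gamma> * r + (norm (x - v))\<^sup>2 / 2"
  let ?S = "{?q x r | x r. f x \<le> ereal r}"
  define m where "m = Inf ?S"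
  obtain x0 c d where d: "d > 0" and lb: "\<And>x r. f x \<le> ereal r \<Longrightarrow> r \<ge> c - norm (x - x0) / d"
    using closed_convex_fun_linear_lower_bound[OF assms(1-3)] by blast
  \<comment> \<open>The constant comes from completing the square in \<open>norm (x - v)\<close>:
    the quadratic term dominates the linear descent of slope \<open>\<gamma> / d\<close>.\<close>
  have "\<gamma> * c - \<gamma> / d * norm (v - x0) - (\<gamma> / d)\<^sup>2 / 2 \<le> ?q x r" if "f x \<le> ereal r" for x r
  proof -
    have "norm (x - x0) \<le> norm (x - v) + norm (v - x0)"
      using norm_triangle_ineq[of "x - v" "v - x0"] by simp
    then have "\<gamma> / d * norm (x - x0) \<le> \<gamma> / d * norm (x - v) + \<gamma> / d * norm (v - x0)"
      unfolding distrib_left[symmetric] using d assms(4) by (intro mult_left_mono) auto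
    moreover have "\<gamma> * r \<ge> \<gamma> * c - \<gamma> / d * norm (x - x0)"
      using mult_left_mono[OF lb[OF that], of \<gamma>] assms(4) by (simp add: right_diff_distrib)
    moreover have "0 \<le> (norm (x - v))\<^sup>2 - 2 * (\<gamma> / d * norm (x - v)) + (\<gamma> / d)\<^sup>2"
      using zero_le_power2[of "norm (x - v) - \<gamma> / d"] by (simp only: power2_diff ac_simps)
    ultimately show ?thesis by linarith
  qed
  then have bdd: "bdd_below ?S" by (intro bdd_belowI) blast
  have ne: "?S \<noteq> {}"
  proof -
    obtain x where "f x \<noteq> \<infinity>" using assms(3) by (auto simp: proper_fun_def)
    then have "f x \<le> ereal (real_of_ereal (f x))" by (cases "f x") auto
    then show ?thesis by blast
  qed
  have lower: "m \<le> ?q x r" if "f x \<le> ereal r" for x r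
    unfolding m_def using that bdd by (intro cInf_lower) auto
  have "\<forall>n. \<exists>x r. f x \<le> ereal r \<and> ?q x r < m + inverse (real (Suc n))"
  proof
    fix n
    have "Inf ?S < m + inverse (real (Suc n))" unfolding m_def by simp
    from cInf_lessD[OF ne this] obtain s where s: "s \<in> ?S" "s < m + inverse (real (Suc n))" ..
    from s(1) obtain x r where "s = ?q x r" "f x \<le> ereal r" by blast
    with s(2) show "\<exists>x r. f x \<le> ereal r \<and> ?q x r < m + inverse (real (Suc n))"
      by (intro exI conjI) simp_all
  qed
  from choice[OF this] obtain X
    where "\<forall>n. \<exists>r. f (X n) \<le> ereal r \<and> ?q (X n) r < m + inverse (real (Suc n))" ..
  from choice[OF this] obtain r where X: "\<And>n. f (X n) \<le> ereal (r n)"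
    and q: "\<And>n. ?q (X n) (r n) < m + inverse (real (Suc n))"
    by blast
  have "Cauchy X"
  proof (rule CauchyI)
    fix e :: real assume "e > 0"
    \<comment> \<open>Two excesses below \<open>e\<^sup>2 / 8\<close> sum to less than
      \<open>e\<^sup>2 / 4\<close>, the scale of the midpoint estimate.\<close>
    then obtain N where N: "inverse (real (Suc N)) < e\<^sup>2 / 8"
      using reals_Archimedean[of "e\<^sup>2 / 8"] by auto
    show "\<exists>M. \<forall>i\<ge>M. \<forall>j\<ge>M. norm (X i - X j) < e"
    proof (intro exI[of _ N] allI impI)
      fix i j assume ij: "N \<le> i" "N \<le> j"
      have tail: "?q (X n) (r n) - m < e\<^sup>2 / 8" if "N \<le> n" for n
      proof -
        have "inverse (real (Suc n)) \<le> inverse (real (Suc N))" using that by simp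
        then show ?thesis using q[of n] N by linarith
      qed
      have "(norm (X i - X j))\<^sup>2 / 4 \<le> (?q (X i) (r i) - m) + (?q (X j) (r j) - m)"
        by (rule prox_objective_midpoint[OF assms(2) X X lower])
      then have "(norm (X i - X j))\<^sup>2 < e\<^sup>2"
        using tail[OF ij(1)] tail[OF ij(2)] by linarith
      then show "norm (X i - X j) < e"
        using \<open>e > 0\<close> by (simp add: power2_less_imp_less)
    qed
  qed
  then obtain z where z: "X \<longlonglongrightarrow> z" by (meson Cauchy_convergent_iff convergent_def)
  \<comment> \<open>The height at which the objective at \<open>z\<close> takes the value
    \<open>m\<close>.\<close>
  define a where "a = (m - (norm (z - v))\<^sup>2 / 2) / \<gamma>"
  have "f z \<le> ereal a"
  \<comment> \<open>Convergence of \<open>r\<close> has not been established, so each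
    \<open>r n\<close> is replaced by the larger height that \<open>q\<close> allows; these heights
    converge to \<open>a\<close>.\<close>
  proof (rule closed_fun_tendsto_le[OF assms(1) _ z])
    fix n
    have "r n \<le> (m + inverse (real (Suc n)) - (norm (X n - v))\<^sup>2 / 2) / \<gamma>"
      using q[of n] unfolding pos_le_divide_eq[OF assms(4)] mult.commute[of "r n"] by linarith
    then have "ereal (r n) \<le> ereal ((m + inverse (real (Suc n)) - (norm (X n - v))\<^sup>2 / 2) / \<gamma>)"
      by (simp only: ereal_less_eq)
    with X[of n] show "f (X n) \<le> ereal ((m + inverse (real (Suc n)) - (norm (X n - v))\<^sup>2 / 2) / \<gamma>)"
      by (rule order_trans)
  next
    have "(\<lambda>n. (m + inverse (real (Suc n)) - (norm (X n - v))\<^sup>2 / 2) / \<gamma>)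
        \<longlonglongrightarrow> (m + 0 - (norm (z - v))\<^sup>2 / 2) / \<gamma>"
      using assms(4)
      by (intro tendsto_divide tendsto_diff tendsto_add tendsto_power tendsto_norm tendsto_const
          LIMSEQ_inverse_real_of_nat z) auto
    then show "(\<lambda>n. (m + inverse (real (Suc n)) - (norm (X n - v))\<^sup>2 / 2) / \<gamma>) \<longlonglongrightarrow> a"
      by (simp add: a_def)
  qed
  moreover have "\<gamma> * a + (norm (z - v))\<^sup>2 / 2 = m" using assms(4) by (simp add: a_def)
  ultimately show ?thesis using lower by (intro exI[of _ z] exI[of _ a]) simp
qed

theorem ex1_prox_minimizer:
  fixes f :: "'a::{real_inner, complete_space} \<Rightarrow> ereal"
  assumes "closed_fun f" "convex_fun f" "proper_fun f" "\<gamma> > 0"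
  shows "\<exists>!z. is_arg_min (\<lambda>z. ereal \<gamma> * f z + ereal (1 / 2 * (norm (z - v))\<^sup>2)) (\<lambda>_. True) z"
proof -
  let ?G = "\<lambda>z. ereal \<gamma> * f z + ereal (1 / 2 * (norm (z - v))\<^sup>2)"
  obtain z a where z: "f z \<le> ereal a" and
    min: "\<And>x r. f x \<le> ereal r \<Longrightarrow> \<gamma> * a + (norm (z - v))\<^sup>2 / 2 \<le> \<gamma> * r + (norm (x - v))\<^sup>2 / 2"
    using epigraph_prox_objective_minimizer[OF assms, of v] by blast
  define m where "m = \<gamma> * a + (norm (z - v))\<^sup>2 / 2"
  \<comment> \<open>For finite \<open>f y\<close> the real value is an epigraph height; for infinite
    \<open>f y\<close> the objective is infinite, as \<open>\<gamma> > 0\<close>.\<close>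
  have lower: "ereal m \<le> ?G y" for y
    using min[of y "real_of_ereal (f y)"] assms(3,4)
    by (cases "f y") (auto simp: proper_fun_def m_def)
  have upper: "?G z \<le> ereal m"
    using z assms(3,4) by (cases "f z") (auto simp: proper_fun_def m_def)
  show ?thesis
  proof (rule ex1I[of _ z])
    show "is_arg_min ?G (\<lambda>_. True) z"
      using lower upper by (auto simp: is_arg_min_def not_less intro: order_trans)
  next
    fix y assume "is_arg_min ?G (\<lambda>_. True) y"
    then have "?G y \<le> ereal m"
      using upper by (auto simp: is_arg_min_def not_less intro: order_trans)
    then obtain b where b: "f y = ereal b" "\<gamma> * b + (norm (y - v))\<^sup>2 / 2 \<le> m"
      using assms(3,4) by (cases "f y") (auto simp: proper_fun_def)
    have "(norm (y - z))\<^sup>2 / 4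
        \<le> (\<gamma> * b + (norm (y - v))\<^sup>2 / 2 - m) + (\<gamma> * a + (norm (z - v))\<^sup>2 / 2 - m)"
      using b(1) z min by (intro prox_objective_midpoint[OF assms(2)]) (auto simp: m_def)
    then have "(norm (y - z))\<^sup>2 \<le> 0" using b(2) unfolding m_def by linarith
    then show "y = z" by simp
  qed
qed

section \<open>Change of variables between the two operators\<close>

lemma is_arg_min_prox_right_iff:
  fixes f :: "'a::real_inner \<Rightarrow> ereal"
  assumes "\<rho> \<noteq> 0"
  shows "is_arg_min (\<lambda>z. f (\<rho> *\<^sub>R z) + ereal (1 / 2 * (norm (z - v))\<^sup>2)) (\<lambda>_. True) z \<longleftrightarrow>
    is_arg_min (\<lambda>z. ereal (\<rho>\<^sup>2) * f z + ereal (1 / 2 * (norm (z - \<rho> *\<^sub>R v))\<^sup>2)) (\<lambda>_. True) (\<rho> *\<^sub>R z)"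
    (is "is_arg_min ?R _ z \<longleftrightarrow> is_arg_min ?G _ _")
proof -
  have pos: "\<rho>\<^sup>2 > 0" using assms by simp
  have scale: "?G (\<rho> *\<^sub>R y) = ereal (\<rho>\<^sup>2) * ?R y" for y
  proof -
    have "norm (\<rho> *\<^sub>R y - \<rho> *\<^sub>R v) = \<bar>\<rho>\<bar> * norm (y - v)"
      by (metis norm_scaleR scaleR_diff_right)
    then show ?thesis
      using pos by (cases "f (\<rho> *\<^sub>R y)") (auto simp: power_mult_distrib algebra_simps)
  qed
  have less: "?G (\<rho> *\<^sub>R y) < ?G (\<rho> *\<^sub>R z) \<longleftrightarrow> ?R y < ?R z" for y z
    unfolding scale using pos by (cases "?R y"; cases "?R z") auto
  \<comment> \<open>Scaling by \<open>\<rho>\<close> is surjective, so every competitor of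
    \<open>\<rho> *\<^sub>R z\<close> has the form \<open>\<rho> *\<^sub>R y\<close>.\<close>
  have ex: "(\<exists>y. Q y) \<longleftrightarrow> (\<exists>y. Q (\<rho> *\<^sub>R y))" for Q :: "'a \<Rightarrow> bool"
  proof
    assume "\<exists>y. Q y"
    then obtain y where "Q y" ..
    then have "Q (\<rho> *\<^sub>R (1 / \<rho>) *\<^sub>R y)" using assms by simp
    then show "\<exists>y. Q (\<rho> *\<^sub>R y)" ..
  qed blast
  show ?thesis
    unfolding is_arg_min_def ex[of "\<lambda>y. True \<and> ?G y < ?G (\<rho> *\<^sub>R z)"] less ..
qed

lemma prox_right_eq_prox:
  fixes f :: "'a::{real_inner, complete_space} \<Rightarrow> ereal"
  assumes "closed_fun f" "convex_fun f" "proper_fun f" "\<rho> \<noteq> 0"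
  shows "prox_right f \<rho> v = (1 / \<rho>) *\<^sub>R prox (\<rho>\<^sup>2) f (\<rho> *\<^sub>R v)"
proof -
  let ?P = "is_arg_min (\<lambda>z. ereal (\<rho>\<^sup>2) * f z + ereal (1 / 2 * (norm (z - \<rho> *\<^sub>R v))\<^sup>2)) (\<lambda>_. True)"
  have ex1: "\<exists>!z. ?P z" using assms by (intro ex1_prox_minimizer) auto
  have P: "?P (prox (\<rho>\<^sup>2) f (\<rho> *\<^sub>R v))" unfolding prox_def by (rule theI'[OF ex1])
  \<comment> \<open>After rewriting, \<open>prox_right\<close> describes the unique \<open>z\<close>
    for which \<open>\<rho> *\<^sub>R z\<close> is the classical minimizer.\<close>
  show ?thesis
    unfolding prox_right_def is_arg_min_prox_right_iff[OF assms(4)]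
  proof (rule the_equality)
    show "?P (\<rho> *\<^sub>R (1 / \<rho>) *\<^sub>R prox (\<rho>\<^sup>2) f (\<rho> *\<^sub>R v))" using P assms(4) by simp
  next
    fix z assume "?P (\<rho> *\<^sub>R z)"
    then have "\<rho> *\<^sub>R z = prox (\<rho>\<^sup>2) f (\<rho> *\<^sub>R v)" using P ex1 by blast
    then show "z = (1 / \<rho>) *\<^sub>R prox (\<rho>\<^sup>2) f (\<rho> *\<^sub>R v)"
      using assms(4) by (metis divideR_right inverse_eq_divide)
  qed
qed

theorem lemma2p1:
  fixes f :: "'a::{real_inner, complete_space} \<Rightarrow> ereal"
    and \<rho> \<gamma> :: real and v :: 'a
  assumes "closed_fun f" and "convex_fun f" and "proper_fun f"
    and "\<rho> \<noteq> 0" and "\<gamma> > 0"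
  shows "prox_right f \<rho> v = (1 / \<rho>) *\<^sub>R prox (\<rho>\<^sup>2) f (\<rho> *\<^sub>R v) \<and>
    prox \<gamma> f v = sqrt \<gamma> *\<^sub>R prox_right f (sqrt \<gamma>) ((1 / sqrt \<gamma>) *\<^sub>R v)"
proof
  show "prox_right f \<rho> v = (1 / \<rho>) *\<^sub>R prox (\<rho>\<^sup>2) f (\<rho> *\<^sub>R v)"
    by (rule prox_right_eq_prox[OF assms(1-4)])
  \<comment> \<open>The second identity is the first one with \<open>sqrt \<gamma>\<close> for
    \<open>\<rho>\<close>, at the point \<open>(1 / sqrt \<gamma>) *\<^sub>R v\<close>.\<close>
  have \<gamma>: "sqrt \<gamma> \<noteq> 0" "(sqrt \<gamma>)\<^sup>2 = \<gamma>" using assms(5) by auto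
  then show "prox \<gamma> f v = sqrt \<gamma> *\<^sub>R prox_right f (sqrt \<gamma>) ((1 / sqrt \<gamma>) *\<^sub>R v)"
    unfolding prox_right_eq_prox[OF assms(1-3) \<gamma>(1)] by simp
qed

end
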